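(* Let $H$ be a finite group with $H \neq 1$, let $k$ be a field, and let $G$ be a group containing $H \wr \mathbb{Z}$ as a subgroup. Then the group algebra $kG$ is not an Ore ring, i.e. $kG$ does not satisfy the Ore condition.
   Context: For a group $A$, $A \wr \mathbb{Z}$ denotes the (restricted) wreath product $B \rtimes \mathbb{Z}$ with base group $B = \bigoplus_{i=-\infty}^{\infty} A_i$, $A_i = A$ for all $i$, where a generator $x$ of $\mathbb{Z}$ acts by shifting: $x^i A_0 x^{-i} = A_i$. A ring $R$ satisfies the Ore condition (is an Ore ring) if for any $s,t \in R$ with $s$ a non-zerodivisor, there are $x,y \in R$ with $x$ a non-zerodivisor such that $sy = tx$. An element $s$ is a non-zerodivisor if $sb = 0$ or $bs = 0$ implies $b = 0$. (This is the right Ore condition; for group rings the right and left Ore conditions are equivalent.) *)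

theory Defs
  imports "HOL-Algebra.Product_Groups" "HOL-Algebra.Ring"
begin

section \<open>The wreath product with the integers\<close>

definition semidirect_product ::
  "('a, 'm) monoid_scheme \<Rightarrow> ('b, 'n) monoid_scheme \<Rightarrow> ('b \<Rightarrow> 'a \<Rightarrow> 'a) \<Rightarrow> ('a \<times> 'b) monoid"
  where "semidirect_product N Q \<phi> =
    \<lparr>carrier = carrier N \<times> carrier Q,
     monoid.mult = (\<lambda>(a, p) (b, q). (a \<otimes>\<^bsub>N\<^esub> \<phi> p b, p \<otimes>\<^bsub>Q\<^esub> q)),
     one = (\<one>\<^bsub>N\<^esub>, \<one>\<^bsub>Q\<^esub>)\<rparr>"

definition shift :: "int \<Rightarrow> (int \<Rightarrow> 'a) \<Rightarrow> int \<Rightarrow> 'a"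
  where "shift n f = (\<lambda>i. f (i - n))"

text \<open>The base group is the direct sum (finitely supported families) of copies of \<open>A\<close> indexed
  by the integers. The integer \<open>n\<close> moves the \<open>i\<close>-th copy to the \<open>(i + n)\<close>-th one.\<close>

definition wreath_int :: "('a, 'm) monoid_scheme \<Rightarrow> ((int \<Rightarrow> 'a) \<times> int) monoid"
  where "wreath_int A = semidirect_product (sum_group UNIV (\<lambda>_. A)) integer_group shift"

lemma carrier_wreath_int:
  assumes "group A"
  shows "carrier (wreath_int A) =
    {f. (\<forall>i. f i \<in> carrier A) \<and> finite {i. f i \<noteq> \<one>\<^bsub>A\<^esub>}} \<times> UNIV"
  using assms by (auto simp: wreath_int_def semidirect_product_def carrier_sum_group)

lemma mult_wreath_int:
  "(f, m) \<otimes>\<^bsub>wreath_int A\<^esub> (g, n) = (\<lambda>i. f i \<otimes>\<^bsub>A\<^esub> g (i - m), m + n)"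
  by (simp add: wreath_int_def semidirect_product_def shift_def restrict_def)

lemma one_wreath_int: "\<one>\<^bsub>wreath_int A\<^esub> = (\<lambda>_. \<one>\<^bsub>A\<^esub>, 0)"
  by (simp add: wreath_int_def semidirect_product_def restrict_def)

lemma finite_shift: "finite {i::int. P (i - n)} \<longleftrightarrow> finite {i. P i}"
proof -
  have "bij_betw (\<lambda>i. i - n) {i. P (i - n)} {i. P i}"
    by (rule bij_betwI[where g = "\<lambda>i. i + n"]) auto
  then show ?thesis
    by (rule bij_betw_finite)
qed

lemma group_wreath_int:
  assumes "group A"
  shows "group (wreath_int A)"
proof -
  interpret group A by fact
  show ?thesis
  proof (rule groupI)
    fix x y
    assume "x \<in> carrier (wreath_int A)" "y \<in> carrier (wreath_int A)"
    then obtain f m g n where x: "x = (f, m)" and y: "y = (g, n)"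
      and f: "\<And>i. f i \<in> carrier A" "finite {i. f i \<noteq> \<one>\<^bsub>A\<^esub>}"
      and g: "\<And>i. g i \<in> carrier A" "finite {i. g i \<noteq> \<one>\<^bsub>A\<^esub>}"
      by (auto simp: carrier_wreath_int[OF assms])
    have "finite {i. g (i - m) \<noteq> \<one>\<^bsub>A\<^esub>}"
      using g(2) finite_shift[of "\<lambda>i. g i \<noteq> \<one>\<^bsub>A\<^esub>" m] by simp
    then have "finite ({i. f i \<noteq> \<one>\<^bsub>A\<^esub>} \<union> {i. g (i - m) \<noteq> \<one>\<^bsub>A\<^esub>})"
      using f(2) by simp
    then have "finite {i. f i \<otimes>\<^bsub>A\<^esub> g (i - m) \<noteq> \<one>\<^bsub>A\<^esub>}"
      by (rule rev_finite_subset) auto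
    then show "x \<otimes>\<^bsub>wreath_int A\<^esub> y \<in> carrier (wreath_int A)"
      by (simp add: x y mult_wreath_int carrier_wreath_int[OF assms] f g)
  next
    show "\<one>\<^bsub>wreath_int A\<^esub> \<in> carrier (wreath_int A)"
      by (simp add: one_wreath_int carrier_wreath_int[OF assms])
  next
    fix x y z
    assume "x \<in> carrier (wreath_int A)" "y \<in> carrier (wreath_int A)" "z \<in> carrier (wreath_int A)"
    then show "x \<otimes>\<^bsub>wreath_int A\<^esub> y \<otimes>\<^bsub>wreath_int A\<^esub> z =
        x \<otimes>\<^bsub>wreath_int A\<^esub> (y \<otimes>\<^bsub>wreath_int A\<^esub> z)"
      by (auto simp: carrier_wreath_int[OF assms] mult_wreath_int m_assoc algebra_simps)
  next
    fix x
    assume "x \<in> carrier (wreath_int A)"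
    then show "\<one>\<^bsub>wreath_int A\<^esub> \<otimes>\<^bsub>wreath_int A\<^esub> x = x"
      by (auto simp: carrier_wreath_int[OF assms] mult_wreath_int one_wreath_int)
  next
    fix x
    assume "x \<in> carrier (wreath_int A)"
    then obtain f m where x: "x = (f, m)"
      and f: "\<And>i. f i \<in> carrier A" "finite {i. f i \<noteq> \<one>\<^bsub>A\<^esub>}"
      by (auto simp: carrier_wreath_int[OF assms])
    have "finite {i. f (i + m) \<noteq> \<one>\<^bsub>A\<^esub>}"
      using f(2) finite_shift[of "\<lambda>i. f i \<noteq> \<one>\<^bsub>A\<^esub>" "- m"] by simp
    then have "(\<lambda>i. inv\<^bsub>A\<^esub> f (i + m), - m) \<in> carrier (wreath_int A)"
      using f by (simp add: carrier_wreath_int[OF assms] inv_eq_1_iff)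
    moreover have "(\<lambda>i. inv\<^bsub>A\<^esub> f (i + m), - m) \<otimes>\<^bsub>wreath_int A\<^esub> x = \<one>\<^bsub>wreath_int A\<^esub>"
      using f by (simp add: x mult_wreath_int one_wreath_int)
    ultimately show "\<exists>y\<in>carrier (wreath_int A). y \<otimes>\<^bsub>wreath_int A\<^esub> x = \<one>\<^bsub>wreath_int A\<^esub>"
      by blast
  qed
qed

text \<open>Conjugating the copy of \<open>A\<close> at \<open>0\<close> by the \<open>n\<close>-th power of the generator of the integers
  gives the copy at \<open>n\<close>.\<close>

lemma conj_wreath_int:
  assumes "group A" "a \<in> carrier A"
  shows "(\<lambda>_. \<one>\<^bsub>A\<^esub>, n) \<otimes>\<^bsub>wreath_int A\<^esub> ((\<lambda>_. \<one>\<^bsub>A\<^esub>)(0 := a), 0) \<otimes>\<^bsub>wreath_int A\<^esub> (\<lambda>_. \<one>\<^bsub>A\<^esub>, - n) =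
    ((\<lambda>_. \<one>\<^bsub>A\<^esub>)(n := a), 0)"
proof -
  interpret group A by fact
  show ?thesis
    using assms(2) by (auto simp: mult_wreath_int fun_eq_iff)
qed


section \<open>The group algebra\<close>

text \<open>Elements are the finitely supported functions from the group to the coefficient ring,
  taken to be extensional so that equality is equality on the carrier.\<close>

definition group_algebra ::
  "('k, 'r) ring_scheme \<Rightarrow> ('g, 'm) monoid_scheme \<Rightarrow> ('g \<Rightarrow> 'k) ring"
  where "group_algebra k G =
    \<lparr>carrier = {f \<in> carrier G \<rightarrow>\<^sub>E carrier k. finite {g \<in> carrier G. f g \<noteq> \<zero>\<^bsub>k\<^esub>}},
     monoid.mult = (\<lambda>f f'. \<lambda>g\<in>carrier G.
       \<Oplus>\<^bsub>k\<^esub>u\<in>{u \<in> carrier G. f u \<noteq> \<zero>\<^bsub>k\<^esub>}. f u \<otimes>\<^bsub>k\<^esub> f' (inv\<^bsub>G\<^esub> u \<otimes>\<^bsub>G\<^esub> g)),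
     one = (\<lambda>g\<in>carrier G. if g = \<one>\<^bsub>G\<^esub> then \<one>\<^bsub>k\<^esub> else \<zero>\<^bsub>k\<^esub>),
     zero = (\<lambda>g\<in>carrier G. \<zero>\<^bsub>k\<^esub>),
     add = (\<lambda>f f'. \<lambda>g\<in>carrier G. f g \<oplus>\<^bsub>k\<^esub> f' g)\<rparr>"

lemma carrier_group_algebra:
  "f \<in> carrier (group_algebra k G) \<longleftrightarrow>
    f \<in> carrier G \<rightarrow>\<^sub>E carrier k \<and> finite {g \<in> carrier G. f g \<noteq> \<zero>\<^bsub>k\<^esub>}"
  by (simp add: group_algebra_def)

lemma one_group_algebra:
  "\<one>\<^bsub>group_algebra k G\<^esub> = (\<lambda>g\<in>carrier G. if g = \<one>\<^bsub>G\<^esub> then \<one>\<^bsub>k\<^esub> else \<zero>\<^bsub>k\<^esub>)"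
  by (simp add: group_algebra_def)

lemma zero_group_algebra: "\<zero>\<^bsub>group_algebra k G\<^esub> = (\<lambda>g\<in>carrier G. \<zero>\<^bsub>k\<^esub>)"
  by (simp add: group_algebra_def)

lemma add_group_algebra:
  "f \<oplus>\<^bsub>group_algebra k G\<^esub> f' = (\<lambda>g\<in>carrier G. f g \<oplus>\<^bsub>k\<^esub> f' g)"
  by (simp add: group_algebra_def)

lemma add_group_algebra_app:
  "g \<in> carrier G \<Longrightarrow> (f \<oplus>\<^bsub>group_algebra k G\<^esub> f') g = f g \<oplus>\<^bsub>k\<^esub> f' g"
  by (simp add: add_group_algebra)

lemma (in abelian_monoid) finsum_swap:
  assumes "finite A" "finite B" "\<And>a b. a \<in> A \<Longrightarrow> b \<in> B \<Longrightarrow> f a b \<in> carrier G"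
  shows "(\<Oplus>a\<in>A. \<Oplus>b\<in>B. f a b) = (\<Oplus>b\<in>B. \<Oplus>a\<in>A. f a b)"
  using assms(1,3)
proof (induction A rule: finite_induct)
  case empty
  then show ?case by (simp add: finsum_zero)
next
  case (insert x F)
  have "(\<Oplus>a\<in>insert x F. \<Oplus>b\<in>B. f a b) = (\<Oplus>b\<in>B. f x b) \<oplus> (\<Oplus>a\<in>F. \<Oplus>b\<in>B. f a b)"
    using insert by (intro finsum_insert) (auto intro!: finsum_closed)
  also have "\<dots> = (\<Oplus>b\<in>B. f x b) \<oplus> (\<Oplus>b\<in>B. \<Oplus>a\<in>F. f a b)"
    using insert by simp
  also have "\<dots> = (\<Oplus>b\<in>B. f x b \<oplus> (\<Oplus>a\<in>F. f a b))"
    using insert.prems by (intro finsum_addf[symmetric]) (auto intro!: finsum_closed)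
  also have "\<dots> = (\<Oplus>b\<in>B. \<Oplus>a\<in>insert x F. f a b)"
    using insert by (intro finsum_cong' finsum_insert[symmetric]) (auto intro!: finsum_closed)
  finally show ?case .
qed

locale group_algebra_setup = R: ring k + group G
  for k (structure) and G (structure)
begin

abbreviation supp :: "('c \<Rightarrow> 'a) \<Rightarrow> 'c set"
  where "supp f \<equiv> {g \<in> carrier G. f g \<noteq> \<zero>\<^bsub>k\<^esub>}"

lemma mult_eq:
  assumes f: "f \<in> carrier (group_algebra k G)" and f': "f' \<in> carrier (group_algebra k G)"
    and A: "finite A" "supp f \<subseteq> A" "A \<subseteq> carrier G" and g: "g \<in> carrier G"
  shows "(f \<otimes>\<^bsub>group_algebra k G\<^esub> f') g = (\<Oplus>\<^bsub>k\<^esub>u\<in>A. f u \<otimes>\<^bsub>k\<^esub> f' (inv\<^bsub>G\<^esub> u \<otimes>\<^bsub>G\<^esub> g))"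
proof -
  have [simp]: "\<And>u. u \<in> carrier G \<Longrightarrow> f u \<in> carrier k" "\<And>u. u \<in> carrier G \<Longrightarrow> f' u \<in> carrier k"
    using f f' by (auto simp: carrier_group_algebra)
  have "(\<Oplus>\<^bsub>k\<^esub>u\<in>supp f. f u \<otimes>\<^bsub>k\<^esub> f' (inv\<^bsub>G\<^esub> u \<otimes>\<^bsub>G\<^esub> g)) = (\<Oplus>\<^bsub>k\<^esub>u\<in>A. f u \<otimes>\<^bsub>k\<^esub> f' (inv\<^bsub>G\<^esub> u \<otimes>\<^bsub>G\<^esub> g))"
    using A g by (intro R.add.finprod_mono_neutral_cong_left) auto
  then show ?thesis
    using g by (simp add: group_algebra_def)
qed

lemma supp_mult:
  assumes f: "f \<in> carrier (group_algebra k G)" and f': "f' \<in> carrier (group_algebra k G)"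
  shows "supp (f \<otimes>\<^bsub>group_algebra k G\<^esub> f') \<subseteq> (\<lambda>(u, v). u \<otimes>\<^bsub>G\<^esub> v) ` (supp f \<times> supp f')"
proof
  fix g
  assume g: "g \<in> supp (f \<otimes>\<^bsub>group_algebra k G\<^esub> f')"
  have [simp]: "\<And>u. u \<in> carrier G \<Longrightarrow> f u \<in> carrier k" "\<And>u. u \<in> carrier G \<Longrightarrow> f' u \<in> carrier k"
    using f f' by (auto simp: carrier_group_algebra)
  have "\<exists>u\<in>supp f. f' (inv\<^bsub>G\<^esub> u \<otimes>\<^bsub>G\<^esub> g) \<noteq> \<zero>\<^bsub>k\<^esub>"
  proof (rule ccontr)
    assume "\<not> ?thesis"
    then have "(\<Oplus>\<^bsub>k\<^esub>u\<in>supp f. f u \<otimes>\<^bsub>k\<^esub> f' (inv\<^bsub>G\<^esub> u \<otimes>\<^bsub>G\<^esub> g)) = (\<Oplus>\<^bsub>k\<^esub>u\<in>supp f. \<zero>\<^bsub>k\<^esub>)"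
      by (intro R.finsum_cong') auto
    then show False
      using g by (auto simp: group_algebra_def)
  qed
  then obtain u where "u \<in> supp f" "f' (inv\<^bsub>G\<^esub> u \<otimes>\<^bsub>G\<^esub> g) \<noteq> \<zero>\<^bsub>k\<^esub>" by blast
  then show "g \<in> (\<lambda>(u, v). u \<otimes>\<^bsub>G\<^esub> v) ` (supp f \<times> supp f')"
    using g by (intro image_eqI[of _ _ "(u, inv\<^bsub>G\<^esub> u \<otimes>\<^bsub>G\<^esub> g)"]) (auto simp: m_assoc[symmetric])
qed

lemma ga_mult_closed:
  assumes f: "f \<in> carrier (group_algebra k G)" and f': "f' \<in> carrier (group_algebra k G)"
  shows "f \<otimes>\<^bsub>group_algebra k G\<^esub> f' \<in> carrier (group_algebra k G)"
proof -
  have "finite (supp (f \<otimes>\<^bsub>group_algebra k G\<^esub> f'))"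
    using f f' by (intro finite_subset[OF supp_mult[OF f f']]) (auto simp: carrier_group_algebra)
  moreover have "f \<otimes>\<^bsub>group_algebra k G\<^esub> f' \<in> carrier G \<rightarrow>\<^sub>E carrier k"
    using f f' by (auto simp: group_algebra_def intro!: R.finsum_closed)
  ultimately show ?thesis by (simp add: carrier_group_algebra)
qed

lemma ga_mult_assoc:
  assumes f: "f \<in> carrier (group_algebra k G)" and f': "f' \<in> carrier (group_algebra k G)"
    and f'': "f'' \<in> carrier (group_algebra k G)"
  shows "f \<otimes>\<^bsub>group_algebra k G\<^esub> f' \<otimes>\<^bsub>group_algebra k G\<^esub> f'' =
    f \<otimes>\<^bsub>group_algebra k G\<^esub> (f' \<otimes>\<^bsub>group_algebra k G\<^esub> f'')" (is "?l = ?r")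
proof -
  have [simp]: "\<And>u. u \<in> carrier G \<Longrightarrow> f u \<in> carrier k" "\<And>u. u \<in> carrier G \<Longrightarrow> f' u \<in> carrier k"
    "\<And>u. u \<in> carrier G \<Longrightarrow> f'' u \<in> carrier k"
    using f f' f'' by (auto simp: carrier_group_algebra)
  have fin: "finite (supp f)" "finite (supp f')"
    using f f' by (auto simp: carrier_group_algebra)
  define P where "P = (\<lambda>(u, v). u \<otimes>\<^bsub>G\<^esub> v) ` (supp f \<times> supp f')"
  have P: "finite P" "P \<subseteq> carrier G" "supp (f \<otimes>\<^bsub>group_algebra k G\<^esub> f') \<subseteq> P"
    using fin supp_mult[OF f f'] by (auto simp: P_def)
  have "?l g = ?r g" if g: "g \<in> carrier G" for g
  proof -
    have "?l g = (\<Oplus>\<^bsub>k\<^esub>w\<in>P. (f \<otimes>\<^bsub>group_algebra k G\<^esub> f') w \<otimes>\<^bsub>k\<^esub> f'' (inv\<^bsub>G\<^esub> w \<otimes>\<^bsub>G\<^esub> g))"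
      using P g by (intro mult_eq ga_mult_closed f f' f'') auto
    also have "\<dots> = (\<Oplus>\<^bsub>k\<^esub>w\<in>P. \<Oplus>\<^bsub>k\<^esub>u\<in>supp f. f u \<otimes>\<^bsub>k\<^esub> f' (inv\<^bsub>G\<^esub> u \<otimes>\<^bsub>G\<^esub> w) \<otimes>\<^bsub>k\<^esub> f'' (inv\<^bsub>G\<^esub> w \<otimes>\<^bsub>G\<^esub> g))"
    proof (rule R.finsum_cong')
      fix w assume "w \<in> P"
      then have w: "w \<in> carrier G" using P by auto
      show "(f \<otimes>\<^bsub>group_algebra k G\<^esub> f') w \<otimes>\<^bsub>k\<^esub> f'' (inv\<^bsub>G\<^esub> w \<otimes>\<^bsub>G\<^esub> g) =
        (\<Oplus>\<^bsub>k\<^esub>u\<in>supp f. f u \<otimes>\<^bsub>k\<^esub> f' (inv\<^bsub>G\<^esub> u \<otimes>\<^bsub>G\<^esub> w) \<otimes>\<^bsub>k\<^esub> f'' (inv\<^bsub>G\<^esub> w \<otimes>\<^bsub>G\<^esub> g))"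
        using w g fin by (subst mult_eq[OF f f' fin(1)]) (auto intro!: R.finsum_ldistr)
    qed (use P g in \<open>auto intro!: R.finsum_closed\<close>)
    also have "\<dots> = (\<Oplus>\<^bsub>k\<^esub>u\<in>supp f. \<Oplus>\<^bsub>k\<^esub>w\<in>P. f u \<otimes>\<^bsub>k\<^esub> f' (inv\<^bsub>G\<^esub> u \<otimes>\<^bsub>G\<^esub> w) \<otimes>\<^bsub>k\<^esub> f'' (inv\<^bsub>G\<^esub> w \<otimes>\<^bsub>G\<^esub> g))"
      using P fin g by (intro R.finsum_swap) auto
    also have "\<dots> = (\<Oplus>\<^bsub>k\<^esub>u\<in>supp f. f u \<otimes>\<^bsub>k\<^esub> (f' \<otimes>\<^bsub>group_algebra k G\<^esub> f'') (inv\<^bsub>G\<^esub> u \<otimes>\<^bsub>G\<^esub> g))"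
    proof (rule R.finsum_cong')
      fix u assume u: "u \<in> supp f"
      let ?h = "\<lambda>w. inv\<^bsub>G\<^esub> u \<otimes>\<^bsub>G\<^esub> w"
      have inj: "inj_on ?h P"
        using u P by (intro inj_on_inverseI[where g = "\<lambda>w. u \<otimes>\<^bsub>G\<^esub> w"]) (auto simp: m_assoc[symmetric])
      have sub: "supp f' \<subseteq> ?h ` P"
      proof
        fix v assume v: "v \<in> supp f'"
        with u have "u \<otimes>\<^bsub>G\<^esub> v \<in> P" by (auto simp: P_def)
        moreover have "v = ?h (u \<otimes>\<^bsub>G\<^esub> v)" using u v by (simp add: m_assoc[symmetric])
        ultimately show "v \<in> ?h ` P" by blast
      qed
      have "(f' \<otimes>\<^bsub>group_algebra k G\<^esub> f'') (inv\<^bsub>G\<^esub> u \<otimes>\<^bsub>G\<^esub> g) =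
        (\<Oplus>\<^bsub>k\<^esub>v\<in>?h ` P. f' v \<otimes>\<^bsub>k\<^esub> f'' (inv\<^bsub>G\<^esub> v \<otimes>\<^bsub>G\<^esub> (inv\<^bsub>G\<^esub> u \<otimes>\<^bsub>G\<^esub> g)))"
        using u g P sub by (intro mult_eq f' f'') auto
      also have "\<dots> = (\<Oplus>\<^bsub>k\<^esub>w\<in>P. f' (?h w) \<otimes>\<^bsub>k\<^esub> f'' (inv\<^bsub>G\<^esub> (?h w) \<otimes>\<^bsub>G\<^esub> (inv\<^bsub>G\<^esub> u \<otimes>\<^bsub>G\<^esub> g)))"
        using u g P by (intro R.finsum_reindex inj) auto
      also have "\<dots> = (\<Oplus>\<^bsub>k\<^esub>w\<in>P. f' (?h w) \<otimes>\<^bsub>k\<^esub> f'' (inv\<^bsub>G\<^esub> w \<otimes>\<^bsub>G\<^esub> g))"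
      proof (rule R.finsum_cong')
        fix w assume "w \<in> P"
        then have w: "w \<in> carrier G" using P by auto
        have "u \<otimes>\<^bsub>G\<^esub> (inv\<^bsub>G\<^esub> u \<otimes>\<^bsub>G\<^esub> g) = g"
          using u g by (simp add: m_assoc[symmetric])
        then have "inv\<^bsub>G\<^esub> (?h w) \<otimes>\<^bsub>G\<^esub> (inv\<^bsub>G\<^esub> u \<otimes>\<^bsub>G\<^esub> g) = inv\<^bsub>G\<^esub> w \<otimes>\<^bsub>G\<^esub> g"
          using u w g by (simp add: inv_mult_group m_assoc)
        then show "f' (?h w) \<otimes>\<^bsub>k\<^esub> f'' (inv\<^bsub>G\<^esub> (?h w) \<otimes>\<^bsub>G\<^esub> (inv\<^bsub>G\<^esub> u \<otimes>\<^bsub>G\<^esub> g)) =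
          f' (?h w) \<otimes>\<^bsub>k\<^esub> f'' (inv\<^bsub>G\<^esub> w \<otimes>\<^bsub>G\<^esub> g)"
          using u w by simp
      qed (use u P g in auto)
      finally have "f u \<otimes>\<^bsub>k\<^esub> (f' \<otimes>\<^bsub>group_algebra k G\<^esub> f'') (inv\<^bsub>G\<^esub> u \<otimes>\<^bsub>G\<^esub> g) =
        (\<Oplus>\<^bsub>k\<^esub>w\<in>P. f u \<otimes>\<^bsub>k\<^esub> (f' (?h w) \<otimes>\<^bsub>k\<^esub> f'' (inv\<^bsub>G\<^esub> w \<otimes>\<^bsub>G\<^esub> g)))"
        using u g P by (simp add: R.finsum_rdistr Pi_def subset_iff)
      also have "\<dots> = (\<Oplus>\<^bsub>k\<^esub>w\<in>P. f u \<otimes>\<^bsub>k\<^esub> f' (?h w) \<otimes>\<^bsub>k\<^esub> f'' (inv\<^bsub>G\<^esub> w \<otimes>\<^bsub>G\<^esub> g))"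
        using u g P by (intro R.finsum_cong') (auto simp: R.m_assoc subset_iff)
      finally show "(\<Oplus>\<^bsub>k\<^esub>w\<in>P. f u \<otimes>\<^bsub>k\<^esub> f' (?h w) \<otimes>\<^bsub>k\<^esub> f'' (inv\<^bsub>G\<^esub> w \<otimes>\<^bsub>G\<^esub> g)) =
        f u \<otimes>\<^bsub>k\<^esub> (f' \<otimes>\<^bsub>group_algebra k G\<^esub> f'') (inv\<^bsub>G\<^esub> u \<otimes>\<^bsub>G\<^esub> g)" by simp
    next
      have "(f' \<otimes>\<^bsub>group_algebra k G\<^esub> f'') \<in> carrier G \<rightarrow> carrier k"
        using ga_mult_closed[OF f' f''] by (auto simp: carrier_group_algebra)
      then show "(\<lambda>u. f u \<otimes>\<^bsub>k\<^esub> (f' \<otimes>\<^bsub>group_algebra k G\<^esub> f'') (inv\<^bsub>G\<^esub> u \<otimes>\<^bsub>G\<^esub> g)) \<in> supp f \<rightarrow> carrier k"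
        using g by (auto simp: Pi_iff)
    qed simp
    also have "\<dots> = ?r g"
      using fin g by (intro mult_eq[symmetric] ga_mult_closed f f' f'') auto
    finally show ?thesis .
  qed
  moreover have "?l \<in> extensional (carrier G)" "?r \<in> extensional (carrier G)"
    by (auto simp: group_algebra_def)
  ultimately show ?thesis
    by (intro extensionalityI[of _ "carrier G"]) auto
qed

lemma ga_one_closed: "\<one>\<^bsub>group_algebra k G\<^esub> \<in> carrier (group_algebra k G)"
proof -
  have "supp \<one>\<^bsub>group_algebra k G\<^esub> \<subseteq> {\<one>\<^bsub>G\<^esub>}"
    by (auto simp: one_group_algebra split: if_splits)
  then show ?thesis
    by (auto simp: carrier_group_algebra one_group_algebra dest: finite_subset)
qed

lemma ga_add_closed:
  assumes f: "f \<in> carrier (group_algebra k G)" and f': "f' \<in> carrier (group_algebra k G)"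
  shows "f \<oplus>\<^bsub>group_algebra k G\<^esub> f' \<in> carrier (group_algebra k G)"
proof -
  have "supp (f \<oplus>\<^bsub>group_algebra k G\<^esub> f') \<subseteq> supp f \<union> supp f'"
    by (auto simp: add_group_algebra)
  then have "finite (supp (f \<oplus>\<^bsub>group_algebra k G\<^esub> f'))"
    using f f' by (auto simp: carrier_group_algebra intro: finite_subset)
  then show ?thesis
    using f f' by (auto simp: carrier_group_algebra add_group_algebra)
qed

theorem ring_group_algebra: "ring (group_algebra k G)"
proof (rule ringI)
  let ?A = "group_algebra k G"
  have car: "f u \<in> carrier k" if "f \<in> carrier ?A" "u \<in> carrier G" for f u
    using that by (auto simp: carrier_group_algebra)
  have ext: "f \<in> extensional (carrier G)" if "f \<in> carrier ?A" for f
    using that by (auto simp: carrier_group_algebra PiE_def)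
  have fin: "finite (supp f)" if "f \<in> carrier ?A" for f
    using that by (auto simp: carrier_group_algebra)
  show "abelian_group ?A"
  proof (rule abelian_groupI)
    fix x y assume "x \<in> carrier ?A" "y \<in> carrier ?A"
    then show "x \<oplus>\<^bsub>?A\<^esub> y \<in> carrier ?A" by (rule ga_add_closed)
  next
    show "\<zero>\<^bsub>?A\<^esub> \<in> carrier ?A"
      by (auto simp: carrier_group_algebra zero_group_algebra cong: conj_cong)
  next
    fix x y z assume "x \<in> carrier ?A" "y \<in> carrier ?A" "z \<in> carrier ?A"
    then show "x \<oplus>\<^bsub>?A\<^esub> y \<oplus>\<^bsub>?A\<^esub> z = x \<oplus>\<^bsub>?A\<^esub> (y \<oplus>\<^bsub>?A\<^esub> z)"
      by (auto simp: add_group_algebra car R.a_assoc intro!: restrict_ext)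
  next
    fix x y assume "x \<in> carrier ?A" "y \<in> carrier ?A"
    then show "x \<oplus>\<^bsub>?A\<^esub> y = y \<oplus>\<^bsub>?A\<^esub> x"
      by (auto simp: add_group_algebra car R.a_comm intro!: restrict_ext)
  next
    fix x assume x: "x \<in> carrier ?A"
    show "\<zero>\<^bsub>?A\<^esub> \<oplus>\<^bsub>?A\<^esub> x = x"
      by (rule extensionalityI[of _ "carrier G"])
        (use x ext[OF x] in \<open>auto simp: add_group_algebra zero_group_algebra car\<close>)
    let ?y = "\<lambda>g\<in>carrier G. \<ominus>\<^bsub>k\<^esub> x g"
    have "supp ?y \<subseteq> supp x"
      using x car by auto
    then have "finite (supp ?y)"
      using fin[OF x] by (rule finite_subset)
    then have "?y \<in> carrier ?A"
      using x by (auto simp: carrier_group_algebra)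
    moreover have "?y \<oplus>\<^bsub>?A\<^esub> x = \<zero>\<^bsub>?A\<^esub>"
      using x by (auto simp: add_group_algebra zero_group_algebra car R.l_neg intro!: restrict_ext)
    ultimately show "\<exists>y\<in>carrier ?A. y \<oplus>\<^bsub>?A\<^esub> x = \<zero>\<^bsub>?A\<^esub>" by blast
  qed
  show "monoid ?A"
  proof (rule monoidI)
    fix x assume x: "x \<in> carrier ?A"
    show "\<one>\<^bsub>?A\<^esub> \<otimes>\<^bsub>?A\<^esub> x = x"
    proof (rule extensionalityI[of _ "carrier G"])
      fix g assume g: "g \<in> carrier G"
      have "(\<one>\<^bsub>?A\<^esub> \<otimes>\<^bsub>?A\<^esub> x) g = (\<Oplus>\<^bsub>k\<^esub>u\<in>{\<one>\<^bsub>G\<^esub>}. \<one>\<^bsub>?A\<^esub> u \<otimes>\<^bsub>k\<^esub> x (inv\<^bsub>G\<^esub> u \<otimes>\<^bsub>G\<^esub> g))"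
        using g by (intro mult_eq ga_one_closed x) (auto simp: one_group_algebra split: if_splits)
      also have "\<dots> = x g"
        using g x by (simp add: one_group_algebra car)
      finally show "(\<one>\<^bsub>?A\<^esub> \<otimes>\<^bsub>?A\<^esub> x) g = x g" .
    qed (use ext[OF x] in \<open>auto simp: group_algebra_def\<close>)
    show "x \<otimes>\<^bsub>?A\<^esub> \<one>\<^bsub>?A\<^esub> = x"
    proof (rule extensionalityI[of _ "carrier G"])
      fix g assume g: "g \<in> carrier G"
      have "(x \<otimes>\<^bsub>?A\<^esub> \<one>\<^bsub>?A\<^esub>) g =
          (\<Oplus>\<^bsub>k\<^esub>u\<in>insert g (supp x). x u \<otimes>\<^bsub>k\<^esub> \<one>\<^bsub>?A\<^esub> (inv\<^bsub>G\<^esub> u \<otimes>\<^bsub>G\<^esub> g))"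
        using g fin[OF x] by (intro mult_eq ga_one_closed x) auto
      also have "\<dots> = (\<Oplus>\<^bsub>k\<^esub>u\<in>insert g (supp x). if g = u then x u else \<zero>\<^bsub>k\<^esub>)"
      proof (rule R.finsum_cong')
        fix u assume "u \<in> insert g (supp x)"
        then have u: "u \<in> carrier G" using g by auto
        have "inv\<^bsub>G\<^esub> u \<otimes>\<^bsub>G\<^esub> g = \<one>\<^bsub>G\<^esub> \<longleftrightarrow> g = u"
          using u g by (metis inv_closed inv_equality inv_inv l_inv)
        then show "x u \<otimes>\<^bsub>k\<^esub> \<one>\<^bsub>?A\<^esub> (inv\<^bsub>G\<^esub> u \<otimes>\<^bsub>G\<^esub> g) = (if g = u then x u else \<zero>\<^bsub>k\<^esub>)"
          using u g x by (simp add: one_group_algebra car)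
      qed (use g x car in auto)
      also have "\<dots> = x g"
        using g x fin[OF x] car by (intro R.add.finprod_singleton) auto
      finally show "(x \<otimes>\<^bsub>?A\<^esub> \<one>\<^bsub>?A\<^esub>) g = x g" .
    qed (use ext[OF x] in \<open>auto simp: group_algebra_def\<close>)
  qed (auto intro: ga_mult_closed ga_mult_assoc ga_one_closed)
next
  let ?A = "group_algebra k G"
  have car: "f u \<in> carrier k" if "f \<in> carrier ?A" "u \<in> carrier G" for f u
    using that by (auto simp: carrier_group_algebra)
  fix x y z assume x: "x \<in> carrier ?A" and y: "y \<in> carrier ?A" and z: "z \<in> carrier ?A"
  have fin: "finite (supp x)" "finite (supp y)" "finite (supp z)"
    using x y z by (auto simp: carrier_group_algebra)
  let ?U = "supp x \<union> supp y"
  show "(x \<oplus>\<^bsub>?A\<^esub> y) \<otimes>\<^bsub>?A\<^esub> z = x \<otimes>\<^bsub>?A\<^esub> z \<oplus>\<^bsub>?A\<^esub> y \<otimes>\<^bsub>?A\<^esub> z"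
  proof (rule extensionalityI[of _ "carrier G"])
    fix g assume g: "g \<in> carrier G"
    have "((x \<oplus>\<^bsub>?A\<^esub> y) \<otimes>\<^bsub>?A\<^esub> z) g = (\<Oplus>\<^bsub>k\<^esub>u\<in>?U. (x \<oplus>\<^bsub>?A\<^esub> y) u \<otimes>\<^bsub>k\<^esub> z (inv\<^bsub>G\<^esub> u \<otimes>\<^bsub>G\<^esub> g))"
      using g fin by (intro mult_eq ga_add_closed x y z) (auto simp: add_group_algebra)
    also have "\<dots> = (\<Oplus>\<^bsub>k\<^esub>u\<in>?U. x u \<otimes>\<^bsub>k\<^esub> z (inv\<^bsub>G\<^esub> u \<otimes>\<^bsub>G\<^esub> g) \<oplus>\<^bsub>k\<^esub> y u \<otimes>\<^bsub>k\<^esub> z (inv\<^bsub>G\<^esub> u \<otimes>\<^bsub>G\<^esub> g))"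
      using g x y z by (intro R.finsum_cong') (auto simp: add_group_algebra car R.l_distr)
    also have "\<dots> = (\<Oplus>\<^bsub>k\<^esub>u\<in>?U. x u \<otimes>\<^bsub>k\<^esub> z (inv\<^bsub>G\<^esub> u \<otimes>\<^bsub>G\<^esub> g)) \<oplus>\<^bsub>k\<^esub> (\<Oplus>\<^bsub>k\<^esub>u\<in>?U. y u \<otimes>\<^bsub>k\<^esub> z (inv\<^bsub>G\<^esub> u \<otimes>\<^bsub>G\<^esub> g))"
      using g x y z by (intro R.finsum_addf) (auto simp: car)
    also have "(\<Oplus>\<^bsub>k\<^esub>u\<in>?U. x u \<otimes>\<^bsub>k\<^esub> z (inv\<^bsub>G\<^esub> u \<otimes>\<^bsub>G\<^esub> g)) = (x \<otimes>\<^bsub>?A\<^esub> z) g"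
      using g fin by (intro mult_eq[symmetric] x z) auto
    also have "(\<Oplus>\<^bsub>k\<^esub>u\<in>?U. y u \<otimes>\<^bsub>k\<^esub> z (inv\<^bsub>G\<^esub> u \<otimes>\<^bsub>G\<^esub> g)) = (y \<otimes>\<^bsub>?A\<^esub> z) g"
      using g fin by (intro mult_eq[symmetric] y z) auto
    finally show "((x \<oplus>\<^bsub>?A\<^esub> y) \<otimes>\<^bsub>?A\<^esub> z) g = (x \<otimes>\<^bsub>?A\<^esub> z \<oplus>\<^bsub>?A\<^esub> y \<otimes>\<^bsub>?A\<^esub> z) g"
      using g by (simp add: add_group_algebra_app)
  qed (auto simp: group_algebra_def)
  show "z \<otimes>\<^bsub>?A\<^esub> (x \<oplus>\<^bsub>?A\<^esub> y) = z \<otimes>\<^bsub>?A\<^esub> x \<oplus>\<^bsub>?A\<^esub> z \<otimes>\<^bsub>?A\<^esub> y"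
  proof (rule extensionalityI[of _ "carrier G"])
    fix g assume g: "g \<in> carrier G"
    have "(z \<otimes>\<^bsub>?A\<^esub> (x \<oplus>\<^bsub>?A\<^esub> y)) g = (\<Oplus>\<^bsub>k\<^esub>u\<in>supp z. z u \<otimes>\<^bsub>k\<^esub> (x \<oplus>\<^bsub>?A\<^esub> y) (inv\<^bsub>G\<^esub> u \<otimes>\<^bsub>G\<^esub> g))"
      using g fin by (intro mult_eq[OF z ga_add_closed[OF x y]]) auto
    also have "\<dots> = (\<Oplus>\<^bsub>k\<^esub>u\<in>supp z. z u \<otimes>\<^bsub>k\<^esub> x (inv\<^bsub>G\<^esub> u \<otimes>\<^bsub>G\<^esub> g) \<oplus>\<^bsub>k\<^esub> z u \<otimes>\<^bsub>k\<^esub> y (inv\<^bsub>G\<^esub> u \<otimes>\<^bsub>G\<^esub> g))"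
      using g x y z by (intro R.finsum_cong') (auto simp: add_group_algebra car R.r_distr)
    also have "\<dots> = (\<Oplus>\<^bsub>k\<^esub>u\<in>supp z. z u \<otimes>\<^bsub>k\<^esub> x (inv\<^bsub>G\<^esub> u \<otimes>\<^bsub>G\<^esub> g)) \<oplus>\<^bsub>k\<^esub> (\<Oplus>\<^bsub>k\<^esub>u\<in>supp z. z u \<otimes>\<^bsub>k\<^esub> y (inv\<^bsub>G\<^esub> u \<otimes>\<^bsub>G\<^esub> g))"
      using g x y z by (intro R.finsum_addf) (auto simp: car)
    also have "\<dots> = (z \<otimes>\<^bsub>?A\<^esub> x) g \<oplus>\<^bsub>k\<^esub> (z \<otimes>\<^bsub>?A\<^esub> y) g"
      using g by (simp add: group_algebra_def)
    finally show "(z \<otimes>\<^bsub>?A\<^esub> (x \<oplus>\<^bsub>?A\<^esub> y)) g = (z \<otimes>\<^bsub>?A\<^esub> x \<oplus>\<^bsub>?A\<^esub> z \<otimes>\<^bsub>?A\<^esub> y) g"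
      using g by (simp add: add_group_algebra_app)
  qed (auto simp: group_algebra_def)
qed

end



section \<open>The Ore condition\<close>

definition non_zerodivisor :: "('a, 'r) ring_scheme \<Rightarrow> 'a \<Rightarrow> bool"
  where "non_zerodivisor R s \<longleftrightarrow> s \<in> carrier R \<and>
    (\<forall>b\<in>carrier R. s \<otimes>\<^bsub>R\<^esub> b = \<zero>\<^bsub>R\<^esub> \<or> b \<otimes>\<^bsub>R\<^esub> s = \<zero>\<^bsub>R\<^esub> \<longrightarrow> b = \<zero>\<^bsub>R\<^esub>)"

definition ore_condition :: "('a, 'r) ring_scheme \<Rightarrow> bool"
  where "ore_condition R \<longleftrightarrow>
    (\<forall>s\<in>carrier R. \<forall>t\<in>carrier R. non_zerodivisor R s \<longrightarrow>
      (\<exists>x\<in>carrier R. \<exists>y\<in>carrier R. non_zerodivisor R x \<and> s \<otimes>\<^bsub>R\<^esub> y = t \<otimes>\<^bsub>R\<^esub> x))"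

end

theory Submission
  imports Defs "HOL-Algebra.Multiplicative_Group"
begin

text \<open>Let \<open>x\<close> generate the integers in the wreath product, pick \<open>a \<noteq> 1\<close> in \<open>H\<close>, and let \<open>h\<^sub>i\<close> be
  the copy of \<open>a\<close> in the \<open>i\<close>-th copy \<open>H\<^sub>i\<close> of \<open>H\<close>. The Ore condition fails for \<open>s = x - 1\<close> and the
  norm element \<open>t\<close>, the sum of the elements of \<open>H\<^sub>0\<close>: whenever \<open>s y = t z\<close>, there is \<open>b \<noteq> 0\<close> with
  \<open>b z = 0\<close>. On the other hand, \<open>s\<close> is a non-zerodivisor because \<open>x\<close> has infinite
  order, so that an element fixed by multiplication with \<open>x\<close> has a support made of infinite
  orbits, so it is zero (\<open>non_zerodivisor_delta_minus_one\<close>).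

  To find an annihilator of \<open>z\<close>, put \<open>u\<^sub>i = h\<^sub>i - 1 = x\<^sup>i u\<^sub>0 x\<^sup>-\<^sup>i\<close>. Elements of different copies
  commute, so the \<open>u\<^sub>i\<close> commute. Since \<open>u\<^sub>0 t = 0\<close>, multiplying \<open>s y = t z\<close> by \<open>u\<^sub>0\<close> and then by
  \<open>x\<^sup>i\<close> gives \<open>u\<^sub>i x\<^sup>i\<^sup>+\<^sup>1 y = u\<^sub>i x\<^sup>i y\<close> for all \<open>i\<close> (\<open>D_translate_step\<close>). Let \<open>P\<close> be the product
  of the \<open>u\<^sub>i\<close> with \<open>0 < \<bar>i\<bar> \<le> m\<close>. Then
  \<open>P x y = P x\<^sup>2 y = \<dots> = P x\<^sup>m\<^sup>+\<^sup>1 y\<close> and \<open>P y = P x\<^sup>-\<^sup>1 y = \<dots> = P x\<^sup>-\<^sup>m y\<close>.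
  Call the elements of the wreath product with integer component \<open>i\<close> its layer \<open>i\<close>. As \<open>P\<close> is
  supported in the base group, the support of \<open>P x\<^sup>i y\<close> lies in the layer \<open>i\<close> times the finite
  support of \<open>y\<close>, and layers that are far enough apart give disjoint supports
  (\<open>supp_Ds_translate_disjoint\<close>). So for large \<open>m\<close> both chains are zero, and
  \<open>(P t) z = P s y = P x y - P y = 0\<close>.

  Finally \<open>P t \<noteq> 0\<close> (\<open>Ds_nonzero\<close>), because \<open>t\<close> and the factors of \<open>P\<close> involve pairwise different
  copies of \<open>H\<close>; this is why \<open>u\<^sub>0\<close>, which kills \<open>t\<close>, has to be left out of \<open>P\<close>, and why the two
  chains run away from the index \<open>0\<close> in opposite directions.\<close>


section \<open>Group elements inside the group algebra\<close>

context group_algebra_setup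
begin

abbreviation kG :: "('c \<Rightarrow> 'a) ring"
  where "kG \<equiv> group_algebra k G"

sublocale kG: ring kG
  by (rule ring_group_algebra)

definition delta :: "'c \<Rightarrow> 'c \<Rightarrow> 'a"
  where "delta g = (\<lambda>w\<in>carrier G. if w = g then \<one>\<^bsub>k\<^esub> else \<zero>\<^bsub>k\<^esub>)"

lemma coeff_closed: "f \<in> carrier kG \<Longrightarrow> g \<in> carrier G \<Longrightarrow> f g \<in> carrier k"
  by (auto simp: carrier_group_algebra)

lemma finite_supp: "f \<in> carrier kG \<Longrightarrow> finite (supp f)"
  by (simp add: carrier_group_algebra)

lemma kG_eqI:
  assumes "f \<in> carrier kG" "f' \<in> carrier kG" "\<And>g. g \<in> carrier G \<Longrightarrow> f g = f' g"
  shows "f = f'"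
  using assms by (intro extensionalityI[of _ "carrier G"]) (auto simp: carrier_group_algebra PiE_def)

lemma coeff_zero: "g \<in> carrier G \<Longrightarrow> \<zero>\<^bsub>kG\<^esub> g = \<zero>\<^bsub>k\<^esub>"
  by (simp add: zero_group_algebra)

lemma nonzero_iff_supp: "f \<in> carrier kG \<Longrightarrow> f \<noteq> \<zero>\<^bsub>kG\<^esub> \<longleftrightarrow> supp f \<noteq> {}"
  using kG_eqI[of f "\<zero>\<^bsub>kG\<^esub>"] by (auto simp: coeff_zero)

lemma coeff_minus:
  assumes "f \<in> carrier kG" "f' \<in> carrier kG" "g \<in> carrier G"
  shows "(f \<ominus>\<^bsub>kG\<^esub> f') g = f g \<ominus>\<^bsub>k\<^esub> f' g"
proof -
  let ?d = "f \<ominus>\<^bsub>kG\<^esub> f'"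
  have "f = ?d \<oplus>\<^bsub>kG\<^esub> f'"
    using assms by (simp add: kG.minus_eq kG.a_assoc kG.l_neg)
  then have "f g = ?d g \<oplus>\<^bsub>k\<^esub> f' g"
    using add_group_algebra_app[OF assms(3), of k ?d f'] by simp
  moreover have "?d g \<in> carrier k" "f' g \<in> carrier k"
    using assms by (auto intro: coeff_closed)
  ultimately show ?thesis
    by (simp add: R.minus_eq R.a_assoc R.r_neg)
qed

lemma delta_closed: "delta g \<in> carrier kG"
proof -
  have "supp (delta g) \<subseteq> {g}"
    by (auto simp: delta_def)
  then show ?thesis
    by (auto simp: carrier_group_algebra delta_def dest: finite_subset)
qed

lemma coeff_delta_mult:
  assumes f: "f \<in> carrier kG" and g: "g \<in> carrier G" and w: "w \<in> carrier G"
  shows "(delta g \<otimes>\<^bsub>kG\<^esub> f) w = f (inv\<^bsub>G\<^esub> g \<otimes>\<^bsub>G\<^esub> w)"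
proof -
  have "(delta g \<otimes>\<^bsub>kG\<^esub> f) w = (\<Oplus>\<^bsub>k\<^esub>u\<in>{g}. delta g u \<otimes>\<^bsub>k\<^esub> f (inv\<^bsub>G\<^esub> u \<otimes>\<^bsub>G\<^esub> w))"
    using g w by (intro mult_eq delta_closed f) (auto simp: delta_def split: if_splits)
  also have "\<dots> = f (inv\<^bsub>G\<^esub> g \<otimes>\<^bsub>G\<^esub> w)"
    using g w f by (simp add: delta_def coeff_closed)
  finally show ?thesis .
qed

lemma coeff_mult_delta:
  assumes f: "f \<in> carrier kG" and g: "g \<in> carrier G" and w: "w \<in> carrier G"
  shows "(f \<otimes>\<^bsub>kG\<^esub> delta g) w = f (w \<otimes>\<^bsub>G\<^esub> inv\<^bsub>G\<^esub> g)"
proof -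
  let ?v = "w \<otimes>\<^bsub>G\<^esub> inv\<^bsub>G\<^esub> g"
  have v: "?v \<in> carrier G"
    using g w by simp
  have "(f \<otimes>\<^bsub>kG\<^esub> delta g) w =
      (\<Oplus>\<^bsub>k\<^esub>u\<in>insert ?v (supp f). f u \<otimes>\<^bsub>k\<^esub> delta g (inv\<^bsub>G\<^esub> u \<otimes>\<^bsub>G\<^esub> w))"
    using v w finite_supp[OF f] by (intro mult_eq delta_closed f) auto
  also have "\<dots> = (\<Oplus>\<^bsub>k\<^esub>u\<in>insert ?v (supp f). if ?v = u then f u else \<zero>\<^bsub>k\<^esub>)"
  proof (rule R.finsum_cong')
    fix u assume "u \<in> insert ?v (supp f)"
    then have u: "u \<in> carrier G" using v by auto
    have "inv\<^bsub>G\<^esub> u \<otimes>\<^bsub>G\<^esub> w = g \<longleftrightarrow> ?v = u"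
      using u g w by (metis inv_closed inv_solve_left inv_solve_right)
    then show "f u \<otimes>\<^bsub>k\<^esub> delta g (inv\<^bsub>G\<^esub> u \<otimes>\<^bsub>G\<^esub> w) = (if ?v = u then f u else \<zero>\<^bsub>k\<^esub>)"
      using u g w f by (simp add: delta_def coeff_closed)
  qed (use v f in \<open>auto simp: coeff_closed\<close>)
  also have "\<dots> = f ?v"
    using v finite_supp[OF f] f by (intro R.add.finprod_singleton) (auto simp: coeff_closed)
  finally show ?thesis .
qed

lemma delta_mult:
  assumes "g \<in> carrier G" "h \<in> carrier G"
  shows "delta g \<otimes>\<^bsub>kG\<^esub> delta h = delta (g \<otimes>\<^bsub>G\<^esub> h)"
proof (rule kG_eqI)
  fix w assume w: "w \<in> carrier G"
  have "inv\<^bsub>G\<^esub> g \<otimes>\<^bsub>G\<^esub> w = h \<longleftrightarrow> w = g \<otimes>\<^bsub>G\<^esub> h"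
    using assms w by (metis inv_solve_left)
  then show "(delta g \<otimes>\<^bsub>kG\<^esub> delta h) w = delta (g \<otimes>\<^bsub>G\<^esub> h) w"
    using assms w by (simp add: coeff_delta_mult delta_closed) (simp add: delta_def)
qed (auto intro: delta_closed)

lemma delta_one: "delta \<one>\<^bsub>G\<^esub> = \<one>\<^bsub>kG\<^esub>"
  by (simp add: delta_def one_group_algebra)

lemma delta_minus_one_eq_zeroD:
  assumes f: "f \<in> carrier kG" and g: "g \<in> carrier G"
  shows "(delta g \<ominus>\<^bsub>kG\<^esub> \<one>\<^bsub>kG\<^esub>) \<otimes>\<^bsub>kG\<^esub> f = \<zero>\<^bsub>kG\<^esub> \<Longrightarrow> delta g \<otimes>\<^bsub>kG\<^esub> f = f"
    and "f \<otimes>\<^bsub>kG\<^esub> (delta g \<ominus>\<^bsub>kG\<^esub> \<one>\<^bsub>kG\<^esub>) = \<zero>\<^bsub>kG\<^esub> \<Longrightarrow> f \<otimes>\<^bsub>kG\<^esub> delta g = f"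
  using f delta_closed[of g]
  by (simp_all add: kG.minus_eq kG.l_distr kG.r_distr kG.l_minus kG.r_minus)
     (simp_all flip: kG.minus_eq)

text \<open>If the product of \<open>g - 1\<close> and \<open>f\<close> in either order is zero, then \<open>f\<close> is constant on the orbits
  of \<open>g\<close> acting by left or right multiplication. These orbits are infinite, the support of \<open>f\<close> is
  finite.\<close>

lemma non_zerodivisor_delta_minus_one:
  assumes g: "g \<in> carrier G" and inj: "inj (\<lambda>n::nat. g [^]\<^bsub>G\<^esub> n)"
  shows "non_zerodivisor kG (delta g \<ominus>\<^bsub>kG\<^esub> \<one>\<^bsub>kG\<^esub>)"
proof -
  have "f = \<zero>\<^bsub>kG\<^esub>" if f: "f \<in> carrier kG"
    and ann: "(delta g \<ominus>\<^bsub>kG\<^esub> \<one>\<^bsub>kG\<^esub>) \<otimes>\<^bsub>kG\<^esub> f = \<zero>\<^bsub>kG\<^esub> \<or> f \<otimes>\<^bsub>kG\<^esub> (delta g \<ominus>\<^bsub>kG\<^esub> \<one>\<^bsub>kG\<^esub>) = \<zero>\<^bsub>kG\<^esub>" for f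
  proof (rule ccontr)
    assume "f \<noteq> \<zero>\<^bsub>kG\<^esub>"
    then obtain v where v: "v \<in> supp f"
      using nonzero_iff_supp[OF f] by auto
    have "\<exists>p. inj p \<and> (\<forall>n::nat. p n \<in> supp f)"
      using ann
    proof
      assume "(delta g \<ominus>\<^bsub>kG\<^esub> \<one>\<^bsub>kG\<^esub>) \<otimes>\<^bsub>kG\<^esub> f = \<zero>\<^bsub>kG\<^esub>"
      then have *: "f (inv\<^bsub>G\<^esub> g \<otimes>\<^bsub>G\<^esub> w) = f w" if "w \<in> carrier G" for w
        using coeff_delta_mult[OF f g that] delta_minus_one_eq_zeroD(1)[OF f g] by simp
      have "g [^]\<^bsub>G\<^esub> n \<otimes>\<^bsub>G\<^esub> v \<in> supp f" for n :: nat
      proof (induction n)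
        case (Suc n)
        let ?w = "g [^]\<^bsub>G\<^esub> Suc n \<otimes>\<^bsub>G\<^esub> v"
        have "inv\<^bsub>G\<^esub> g \<otimes>\<^bsub>G\<^esub> ?w = g [^]\<^bsub>G\<^esub> n \<otimes>\<^bsub>G\<^esub> v"
          using g v by (simp only: nat_pow_Suc2[OF g]) (simp add: m_assoc inv_solve_left')
        then show ?case
          using *[of ?w] Suc g v by simp
      qed (use v in simp)
      moreover have "inj (\<lambda>n::nat. g [^]\<^bsub>G\<^esub> n \<otimes>\<^bsub>G\<^esub> v)"
        using inj g v by (auto simp: inj_def)
      ultimately show ?thesis by blast
    next
      assume "f \<otimes>\<^bsub>kG\<^esub> (delta g \<ominus>\<^bsub>kG\<^esub> \<one>\<^bsub>kG\<^esub>) = \<zero>\<^bsub>kG\<^esub>"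
      then have *: "f (w \<otimes>\<^bsub>G\<^esub> inv\<^bsub>G\<^esub> g) = f w" if "w \<in> carrier G" for w
        using coeff_mult_delta[OF f g that] delta_minus_one_eq_zeroD(2)[OF f g] by simp
      have "v \<otimes>\<^bsub>G\<^esub> g [^]\<^bsub>G\<^esub> n \<in> supp f" for n :: nat
      proof (induction n)
        case (Suc n)
        let ?w = "v \<otimes>\<^bsub>G\<^esub> g [^]\<^bsub>G\<^esub> Suc n"
        have "?w \<otimes>\<^bsub>G\<^esub> inv\<^bsub>G\<^esub> g = v \<otimes>\<^bsub>G\<^esub> g [^]\<^bsub>G\<^esub> n"
          using g v by (simp add: m_assoc)
        then show ?case
          using *[of ?w] Suc g v by simp
      qed (use v in simp)
      moreover have "inj (\<lambda>n::nat. v \<otimes>\<^bsub>G\<^esub> g [^]\<^bsub>G\<^esub> n)"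
        using inj g v by (auto simp: inj_def)
      ultimately show ?thesis by blast
    qed
    then obtain p :: "nat \<Rightarrow> 'c" where "inj p" "range p \<subseteq> supp f" by auto
    then show False
      using finite_supp[OF f] by (meson finite_subset infinite_UNIV_nat finite_imageD)
  qed
  then show ?thesis
    unfolding non_zerodivisor_def
    using kG.minus_closed[OF delta_closed[of g] kG.one_closed] by blast
qed

end


section \<open>A wreath product inside the group\<close>

text \<open>All computations take place in \<open>G\<close>, through an embedding \<open>\<psi>\<close> of the wreath product, because the
  elements \<open>y\<close> and \<open>z\<close> of a common multiple are supported anywhere in \<open>G\<close>.\<close>

locale wreath_embedding = group_algebra_setup k G + H: group H
  for k (structure) and G (structure) and H (structure) +
  fixes \<psi> :: "(int \<Rightarrow> 'e) \<times> int \<Rightarrow> 'c" and a :: 'e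
  assumes psi_hom: "\<psi> \<in> hom (wreath_int H) G"
    and psi_inj: "inj_on \<psi> (carrier (wreath_int H))"
    and finite_H: "finite (carrier H)"
    and a_closed: "a \<in> carrier H"
    and a_neq_one: "a \<noteq> \<one>\<^bsub>H\<^esub>"
    and one_neq_zero: "\<one>\<^bsub>k\<^esub> \<noteq> \<zero>\<^bsub>k\<^esub>"
begin

definition base :: "(int \<Rightarrow> 'e) set"
  where "base = {b. (\<forall>i. b i \<in> carrier H) \<and> finite {i. b i \<noteq> \<one>\<^bsub>H\<^esub>}}"

definition single :: "int \<Rightarrow> 'e \<Rightarrow> int \<Rightarrow> 'e"
  where "single j c = (\<lambda>_. \<one>\<^bsub>H\<^esub>)(j := c)"

definition X :: "int \<Rightarrow> 'c"
  where "X n = \<psi> (\<lambda>_. \<one>\<^bsub>H\<^esub>, n)"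

definition h :: "int \<Rightarrow> 'c"
  where "h j = \<psi> (single j a, 0)"

lemma base_one: "(\<lambda>_. \<one>\<^bsub>H\<^esub>) \<in> base"
  by (simp add: base_def)

lemma base_single: "c \<in> carrier H \<Longrightarrow> single j c \<in> base"
  by (auto simp: base_def single_def intro: finite_subset[of _ "{j}"])

lemma base_mult:
  assumes "b \<in> base" "c \<in> base"
  shows "(\<lambda>i. b i \<otimes>\<^bsub>H\<^esub> c (i - m)) \<in> base"
  using group.is_monoid[OF group_wreath_int[OF H.is_group]]
    monoid.m_closed[of "wreath_int H" "(b, m)" "(c, m)"] assms
  by (simp add: carrier_wreath_int[OF H.is_group] mult_wreath_int base_def)

lemma psi_closed: "b \<in> base \<Longrightarrow> \<psi> (b, m) \<in> carrier G"
  using psi_hom by (auto simp: hom_def carrier_wreath_int[OF H.is_group] base_def)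

lemma psi_mult:
  assumes "b \<in> base" "c \<in> base"
  shows "\<psi> (b, m) \<otimes>\<^bsub>G\<^esub> \<psi> (c, n) = \<psi> (\<lambda>i. b i \<otimes>\<^bsub>H\<^esub> c (i - m), m + n)"
proof -
  have "(b, m) \<in> carrier (wreath_int H)" "(c, n) \<in> carrier (wreath_int H)"
    using assms by (auto simp: carrier_wreath_int[OF H.is_group] base_def)
  then show ?thesis
    using hom_mult[OF psi_hom] by (simp flip: mult_wreath_int)
qed

lemma psi_eqD:
  assumes "\<psi> (b, m) = \<psi> (c, n)" "b \<in> base" "c \<in> base"
  shows "b = c \<and> m = n"
  using inj_onD[OF psi_inj assms(1)] assms(2,3)
  by (auto simp: carrier_wreath_int[OF H.is_group] base_def)

lemma psi_one: "\<psi> (\<lambda>_. \<one>\<^bsub>H\<^esub>, 0) = \<one>\<^bsub>G\<^esub>"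
  using hom_one[OF psi_hom group_wreath_int[OF H.is_group] is_group]
  by (simp add: one_wreath_int)

lemma X_closed: "X n \<in> carrier G"
  by (simp add: X_def psi_closed base_one)

lemma h_closed: "h j \<in> carrier G"
  by (simp add: h_def psi_closed base_single a_closed)

lemma X_add: "X m \<otimes>\<^bsub>G\<^esub> X n = X (m + n)"
  by (simp add: X_def psi_mult base_one)

lemma X_0: "X 0 = \<one>\<^bsub>G\<^esub>"
  by (simp add: X_def psi_one)

lemma inj_X: "inj X"
  using psi_eqD[OF _ base_one base_one] by (auto simp: inj_def X_def)

lemma X_pow: "X 1 [^]\<^bsub>G\<^esub> (n::nat) = X (int n)"
  by (induction n) (simp_all add: X_0 X_add add.commute)

lemma X_h: "X i \<otimes>\<^bsub>G\<^esub> h j = h (i + j) \<otimes>\<^bsub>G\<^esub> X i"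
proof -
  have "single j a (n - i) = single (i + j) a n" for n
    by (auto simp: single_def)
  then show ?thesis
    using a_closed
    by (simp add: X_def h_def psi_mult base_one base_single)
       (simp add: single_def)
qed

lemma h_commute: "h i \<otimes>\<^bsub>G\<^esub> h j = h j \<otimes>\<^bsub>G\<^esub> h i"
proof -
  have "single i a n \<otimes>\<^bsub>H\<^esub> single j a n = single j a n \<otimes>\<^bsub>H\<^esub> single i a n" for n
    using a_closed by (simp add: single_def)
  then show ?thesis
    using a_closed by (simp add: h_def psi_mult base_single)
qed

text \<open>The subgroup of the base group generated by the copies of \<open>H\<close> with index in \<open>A\<close>.\<close>

definition slab :: "int set \<Rightarrow> 'c set"
  where "slab A = {\<psi> (b, 0) | b. b \<in> base \<and> (\<forall>i. i \<notin> A \<longrightarrow> b i = \<one>\<^bsub>H\<^esub>)}"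

lemma h_slab:
  assumes "g \<in> slab A"
  shows "h j \<otimes>\<^bsub>G\<^esub> g \<in> slab (insert j A)"
    and "j \<notin> A \<Longrightarrow> h j \<otimes>\<^bsub>G\<^esub> g \<notin> slab A"
proof -
  obtain b where b: "b \<in> base" "\<forall>i. i \<notin> A \<longrightarrow> b i = \<one>\<^bsub>H\<^esub>" and g: "g = \<psi> (b, 0)"
    using assms by (auto simp: slab_def)
  define c where "c = (\<lambda>i. single j a i \<otimes>\<^bsub>H\<^esub> b i)"
  have c: "c \<in> base" and eq: "h j \<otimes>\<^bsub>G\<^esub> g = \<psi> (c, 0)"
    using base_mult[OF base_single[OF a_closed] b(1), of j 0]
      psi_mult[OF base_single[OF a_closed] b(1), of j 0 0]
    by (simp_all add: c_def h_def g)
  show "h j \<otimes>\<^bsub>G\<^esub> g \<in> slab (insert j A)"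
    unfolding eq slab_def using c b(2) by (force simp: c_def single_def)
  show "h j \<otimes>\<^bsub>G\<^esub> g \<notin> slab A" if "j \<notin> A"
  proof
    assume "h j \<otimes>\<^bsub>G\<^esub> g \<in> slab A"
    then have "c j = \<one>\<^bsub>H\<^esub>"
      using psi_eqD[OF _ c] that by (fastforce simp: eq slab_def)
    then show False
      using a_closed a_neq_one b(2) that by (simp add: c_def single_def)
  qed
qed


section \<open>The difference operators\<close>

text \<open>Products of the elements \<open>h\<^sub>j - 1\<close> are handled as composed operators indexed by a list: the
  group algebra is not commutative, so there is no product over a set, but the operators commute.\<close>

definition D :: "int \<Rightarrow> ('c \<Rightarrow> 'a) \<Rightarrow> 'c \<Rightarrow> 'a"
  where "D j f = (delta (h j) \<ominus>\<^bsub>kG\<^esub> \<one>\<^bsub>kG\<^esub>) \<otimes>\<^bsub>kG\<^esub> f"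

lemma D_closed: "f \<in> carrier kG \<Longrightarrow> D j f \<in> carrier kG"
  by (simp add: D_def delta_closed)

lemma D_eq: "f \<in> carrier kG \<Longrightarrow> D j f = delta (h j) \<otimes>\<^bsub>kG\<^esub> f \<ominus>\<^bsub>kG\<^esub> f"
  by (simp add: D_def kG.minus_eq kG.l_distr kG.l_minus delta_closed)

lemma coeff_D:
  assumes "f \<in> carrier kG" "w \<in> carrier G"
  shows "D j f w = f (inv\<^bsub>G\<^esub> h j \<otimes>\<^bsub>G\<^esub> w) \<ominus>\<^bsub>k\<^esub> f w"
  using assms by (simp add: D_eq coeff_minus coeff_delta_mult delta_closed h_closed)

lemma D_minus:
  "f \<in> carrier kG \<Longrightarrow> f' \<in> carrier kG \<Longrightarrow> D j (f \<ominus>\<^bsub>kG\<^esub> f') = D j f \<ominus>\<^bsub>kG\<^esub> D j f'"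
  by (simp add: D_def kG.minus_eq kG.r_distr kG.r_minus delta_closed)

lemma D_mult:
  "f \<in> carrier kG \<Longrightarrow> f' \<in> carrier kG \<Longrightarrow> D j (f \<otimes>\<^bsub>kG\<^esub> f') = D j f \<otimes>\<^bsub>kG\<^esub> f'"
  by (simp add: D_def kG.m_assoc delta_closed)

lemma D_commute:
  assumes "f \<in> carrier kG"
  shows "D i (D j f) = D j (D i f)"
proof -
  have "delta (h i) \<otimes>\<^bsub>kG\<^esub> (delta (h j) \<otimes>\<^bsub>kG\<^esub> f) = delta (h j) \<otimes>\<^bsub>kG\<^esub> (delta (h i) \<otimes>\<^bsub>kG\<^esub> f)"
    using assms by (simp add: kG.m_assoc[symmetric] delta_closed delta_mult h_closed h_commute)
  moreover have "delta (h i) \<otimes>\<^bsub>kG\<^esub> D j f =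
      delta (h i) \<otimes>\<^bsub>kG\<^esub> (delta (h j) \<otimes>\<^bsub>kG\<^esub> f) \<ominus>\<^bsub>kG\<^esub> delta (h i) \<otimes>\<^bsub>kG\<^esub> f" for i j
    using assms by (simp add: D_eq kG.minus_eq kG.r_distr kG.r_minus delta_closed)
  ultimately show ?thesis
    using assms
    by (simp add: D_eq[OF D_closed]) (simp add: D_eq kG.minus_eq kG.minus_add delta_closed kG.a_ac)
qed

lemma D_translate:
  assumes "f \<in> carrier kG"
  shows "delta (X i) \<otimes>\<^bsub>kG\<^esub> D j f = D (i + j) (delta (X i) \<otimes>\<^bsub>kG\<^esub> f)"
proof -
  have "delta (X i) \<otimes>\<^bsub>kG\<^esub> (delta (h j) \<otimes>\<^bsub>kG\<^esub> f) = delta (h (i + j)) \<otimes>\<^bsub>kG\<^esub> (delta (X i) \<otimes>\<^bsub>kG\<^esub> f)"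
    using assms by (simp add: kG.m_assoc[symmetric] delta_closed delta_mult h_closed X_closed X_h)
  then show ?thesis
    using assms by (simp add: D_eq kG.minus_eq kG.r_distr kG.r_minus delta_closed)
qed

abbreviation Ds :: "int list \<Rightarrow> ('c \<Rightarrow> 'a) \<Rightarrow> 'c \<Rightarrow> 'a"
  where "Ds js \<equiv> foldr D js"

lemma Ds_closed: "f \<in> carrier kG \<Longrightarrow> Ds js f \<in> carrier kG"
  by (induction js) (auto intro: D_closed)

lemma Ds_minus:
  "f \<in> carrier kG \<Longrightarrow> f' \<in> carrier kG \<Longrightarrow> Ds js (f \<ominus>\<^bsub>kG\<^esub> f') = Ds js f \<ominus>\<^bsub>kG\<^esub> Ds js f'"
  by (induction js) (simp_all add: D_minus Ds_closed)

lemma Ds_mult: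
  "f \<in> carrier kG \<Longrightarrow> f' \<in> carrier kG \<Longrightarrow> Ds js (f \<otimes>\<^bsub>kG\<^esub> f') = Ds js f \<otimes>\<^bsub>kG\<^esub> f'"
  by (induction js) (simp_all add: D_mult Ds_closed)

lemma D_Ds_commute: "f \<in> carrier kG \<Longrightarrow> D j (Ds js f) = Ds js (D j f)"
  by (induction js) (simp_all add: D_commute Ds_closed)

text \<open>By commutativity any factor of the product can be applied first.\<close>

lemma Ds_eq_if_D_eq:
  assumes "f \<in> carrier kG" "f' \<in> carrier kG" "j \<in> set js" "D j f = D j f'"
  shows "Ds js f = Ds js f'"
  using assms(3)
proof (induction js)
  case (Cons i js)
  show ?case
  proof (cases "j \<in> set js")
    case False
    then have "i = j"
      using Cons.prems by simp
    then show ?thesis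
      using assms by (simp add: D_Ds_commute)
  qed (use Cons.IH in simp)
qed simp

lemma supp_D:
  assumes f: "f \<in> carrier kG" and "supp f \<subseteq> V" and V: "\<And>g. g \<in> V \<Longrightarrow> h j \<otimes>\<^bsub>G\<^esub> g \<in> V'" "V \<subseteq> V'"
  shows "supp (D j f) \<subseteq> V'"
proof
  fix w assume w: "w \<in> supp (D j f)"
  let ?v = "inv\<^bsub>G\<^esub> h j \<otimes>\<^bsub>G\<^esub> w"
  have "?v \<in> supp f \<or> w \<in> supp f"
    using w f h_closed[of j] by (auto simp: coeff_D R.minus_eq)
  moreover have "h j \<otimes>\<^bsub>G\<^esub> ?v = w"
    using w h_closed[of j] by (simp add: m_assoc[symmetric])
  ultimately show "w \<in> V'"
    using V(1)[of ?v] V(2) \<open>supp f \<subseteq> V\<close> by (elim disjE) auto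
qed

lemma supp_Ds:
  assumes "f \<in> carrier kG" "supp f \<subseteq> V" "\<And>j g. g \<in> V \<Longrightarrow> h j \<otimes>\<^bsub>G\<^esub> g \<in> V"
  shows "supp (Ds js f) \<subseteq> V"
  using assms
proof (induction js)
  case (Cons j js)
  then show ?case
    using supp_D[OF Ds_closed, of f js V j V] by simp
qed simp

text \<open>An element killed by \<open>h\<^sub>j - 1\<close> has a support that is stable under \<open>h\<^sub>j\<close>, whereas \<open>h\<^sub>j\<close> moves
  everything out of a product of copies of \<open>H\<close> that avoids the index \<open>j\<close>.\<close>

lemma D_nonzero:
  assumes f: "f \<in> carrier kG" and ne: "f \<noteq> \<zero>\<^bsub>kG\<^esub>" and supp: "supp f \<subseteq> slab A" and j: "j \<notin> A"
  shows "D j f \<noteq> \<zero>\<^bsub>kG\<^esub>"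
proof
  assume "D j f = \<zero>\<^bsub>kG\<^esub>"
  then have eq: "delta (h j) \<otimes>\<^bsub>kG\<^esub> f = f"
    using delta_minus_one_eq_zeroD(1)[OF f h_closed] by (simp add: D_def)
  obtain v where v: "v \<in> supp f"
    using ne nonzero_iff_supp[OF f] by auto
  let ?w = "h j \<otimes>\<^bsub>G\<^esub> v"
  have "f ?w = f v"
    using coeff_delta_mult[OF f h_closed, of ?w j] v h_closed[of j]
    by (simp add: eq m_assoc[symmetric])
  then have "?w \<in> slab A"
    using v supp h_closed[of j] by auto
  then show False
    using h_slab(2)[of v A j] v supp j by auto
qed

lemma Ds_nonzero:
  assumes "f \<in> carrier kG" "f \<noteq> \<zero>\<^bsub>kG\<^esub>" "supp f \<subseteq> slab A"
    and "distinct js" "set js \<inter> A = {}"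
  shows "Ds js f \<noteq> \<zero>\<^bsub>kG\<^esub> \<and> supp (Ds js f) \<subseteq> slab (set js \<union> A)"
  using assms
proof (induction js)
  case (Cons j js)
  let ?A = "set js \<union> A"
  have IH: "Ds js f \<noteq> \<zero>\<^bsub>kG\<^esub>" "supp (Ds js f) \<subseteq> slab ?A"
    using Cons by auto
  have "slab ?A \<subseteq> slab (insert j ?A)"
    by (auto simp: slab_def)
  then have "supp (D j (Ds js f)) \<subseteq> slab (insert j ?A)"
    using supp_D[OF Ds_closed[OF Cons.prems(1)] IH(2)] h_slab(1) by blast
  moreover have "D j (Ds js f) \<noteq> \<zero>\<^bsub>kG\<^esub>"
    using D_nonzero[OF Ds_closed[OF Cons.prems(1)] IH] Cons.prems by auto
  ultimately show ?case by simp
qed simp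


section \<open>The norm element\<close>

text \<open>The sum of the elements of the \<open>0\<close>-th copy of \<open>H\<close>, which exists in the group algebra because
  \<open>H\<close> is finite.\<close>

definition norm_elt :: "'c \<Rightarrow> 'a"
  where "norm_elt = (\<lambda>g\<in>carrier G. if g \<in> slab {0} then \<one>\<^bsub>k\<^esub> else \<zero>\<^bsub>k\<^esub>)"

lemma slab_0: "slab {0} = (\<lambda>c. \<psi> (single 0 c, 0)) ` carrier H"
proof
  show "slab {0} \<subseteq> (\<lambda>c. \<psi> (single 0 c, 0)) ` carrier H"
  proof
    fix g assume "g \<in> slab {0}"
    then obtain b where b: "b \<in> base" "\<forall>i. i \<noteq> 0 \<longrightarrow> b i = \<one>\<^bsub>H\<^esub>" "g = \<psi> (b, 0)"
      by (auto simp: slab_def)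
    then have "b = single 0 (b 0)" "b 0 \<in> carrier H"
      by (auto simp: single_def base_def)
    then show "g \<in> (\<lambda>c. \<psi> (single 0 c, 0)) ` carrier H"
      using b(3) by (metis image_eqI)
  qed
  show "(\<lambda>c. \<psi> (single 0 c, 0)) ` carrier H \<subseteq> slab {0}"
    using base_single by (fastforce simp: slab_def single_def)
qed

lemma norm_elt_closed: "norm_elt \<in> carrier kG"
proof -
  have "finite (slab {0})"
    using finite_H by (simp add: slab_0)
  moreover have "supp norm_elt \<subseteq> slab {0}"
    by (auto simp: norm_elt_def)
  ultimately have "finite (supp norm_elt)"
    by (rule finite_subset[rotated])
  then show ?thesis
    by (simp add: carrier_group_algebra) (simp add: norm_elt_def)
qed

lemma norm_elt_nonzero: "norm_elt \<noteq> \<zero>\<^bsub>kG\<^esub>"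
proof -
  have "\<one>\<^bsub>G\<^esub> \<in> slab {0}"
    using psi_one base_one by (force simp: slab_def)
  then have "\<one>\<^bsub>G\<^esub> \<in> supp norm_elt"
    using one_neq_zero by (simp add: norm_elt_def)
  then show ?thesis
    using nonzero_iff_supp[OF norm_elt_closed] by blast
qed

text \<open>The \<open>0\<close>-th copy of \<open>H\<close> is stable under multiplication by its element \<open>h\<^sub>0\<close>.\<close>

lemma D_norm_elt: "D 0 norm_elt = \<zero>\<^bsub>kG\<^esub>"
proof (rule kG_eqI)
  fix w assume w: "w \<in> carrier G"
  let ?v = "inv\<^bsub>G\<^esub> h 0 \<otimes>\<^bsub>G\<^esub> w"
  have v: "?v \<in> carrier G" and hv: "h 0 \<otimes>\<^bsub>G\<^esub> ?v = w"
    using w h_closed[of 0] by (simp_all add: m_assoc[symmetric])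
  have inv: "?v \<in> slab {0}" if w0: "w \<in> slab {0}"
  proof -
    obtain c where c: "c \<in> carrier H" "w = \<psi> (single 0 c, 0)"
      using w0 by (auto simp: slab_0)
    define d where "d = inv\<^bsub>H\<^esub> a \<otimes>\<^bsub>H\<^esub> c"
    have d: "d \<in> carrier H" "a \<otimes>\<^bsub>H\<^esub> d = c"
      using a_closed c by (simp_all add: d_def H.m_assoc[symmetric])
    have "h 0 \<otimes>\<^bsub>G\<^esub> \<psi> (single 0 d, 0) = w"
    proof -
      have "(\<lambda>i. single 0 a i \<otimes>\<^bsub>H\<^esub> single 0 d i) = single 0 c"
        using d(2) by (auto simp: single_def)
      then show ?thesis
        using psi_mult[OF base_single[OF a_closed] base_single[OF d(1)], of 0 0 0 0] c(2)
        by (simp add: h_def)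
    qed
    then have "?v = \<psi> (single 0 d, 0)"
      using psi_closed[OF base_single[OF d(1)]] h_closed by (simp add: inv_solve_left' w)
    then show ?thesis
      using d(1) by (simp add: slab_0)
  qed
  have "?v \<in> slab {0} \<longleftrightarrow> w \<in> slab {0}"
    using inv h_slab(1)[of ?v "{0}" 0] hv by auto
  then show "D 0 norm_elt w = \<zero>\<^bsub>kG\<^esub> w"
    using w v by (simp add: coeff_D norm_elt_closed coeff_zero) (simp add: norm_elt_def R.minus_eq R.r_neg)
qed (simp_all add: D_closed norm_elt_closed)


section \<open>Common multiples\<close>

text \<open>The operators multiply by elements of the base group, hence do not change the layer.\<close>

lemma supp_Ds_translate:
  assumes "y \<in> carrier kG"
  shows "supp (Ds js (delta (X i) \<otimes>\<^bsub>kG\<^esub> y)) \<subseteq> {\<psi> (b, i) \<otimes>\<^bsub>G\<^esub> v | b v. b \<in> base \<and> v \<in> supp y}"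
    (is "_ \<subseteq> ?V")
proof (rule supp_Ds)
  show "supp (delta (X i) \<otimes>\<^bsub>kG\<^esub> y) \<subseteq> ?V"
  proof
    fix w assume w: "w \<in> supp (delta (X i) \<otimes>\<^bsub>kG\<^esub> y)"
    then have "inv\<^bsub>G\<^esub> X i \<otimes>\<^bsub>G\<^esub> w \<in> supp y"
      using coeff_delta_mult[OF assms X_closed] X_closed by auto
    moreover have "w = X i \<otimes>\<^bsub>G\<^esub> (inv\<^bsub>G\<^esub> X i \<otimes>\<^bsub>G\<^esub> w)"
      using w X_closed[of i] by (simp add: m_assoc[symmetric])
    ultimately show "w \<in> ?V"
      using base_one unfolding X_def by blast
  qed
next
  fix j g assume "g \<in> ?V"
  then obtain b v where b: "b \<in> base" and v: "v \<in> supp y" and g: "g = \<psi> (b, i) \<otimes>\<^bsub>G\<^esub> v"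
    by blast
  have "h j \<otimes>\<^bsub>G\<^esub> g = h j \<otimes>\<^bsub>G\<^esub> \<psi> (b, i) \<otimes>\<^bsub>G\<^esub> v"
    using v b by (simp add: g m_assoc h_closed psi_closed)
  also have "h j \<otimes>\<^bsub>G\<^esub> \<psi> (b, i) = \<psi> (\<lambda>n. single j a n \<otimes>\<^bsub>H\<^esub> b n, i)"
    using psi_mult[OF base_single[OF a_closed] b, of j 0 i] by (simp add: h_def)
  finally show "h j \<otimes>\<^bsub>G\<^esub> g \<in> ?V"
    using base_mult[OF base_single[OF a_closed] b, of j 0] v by auto
qed (use assms delta_closed in auto)

text \<open>A common point \<open>w\<close> of the two supports yields points \<open>v\<close>, \<open>v'\<close> in the support of \<open>y\<close> such that
  the quotient of \<open>v\<close> by \<open>v'\<close> is an element of the wreath product in layer \<open>j - i\<close>. There are only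
  finitely many such quotients, and each lies in one layer only.\<close>

lemma supp_Ds_translate_disjoint:
  assumes y: "y \<in> carrier kG"
  shows "\<exists>m>0. \<forall>js i j. i + m \<le> j \<longrightarrow>
    supp (Ds js (delta (X i) \<otimes>\<^bsub>kG\<^esub> y)) \<inter> supp (Ds js (delta (X j) \<otimes>\<^bsub>kG\<^esub> y)) = {}"
proof -
  \<comment> \<open>the differences of layers that occur between points of the support of \<open>y\<close>\<close>
  define E where "E = {d. \<exists>b\<in>base. \<exists>v\<in>supp y. \<exists>v'\<in>supp y. \<psi> (b, d) = v \<otimes>\<^bsub>G\<^esub> inv\<^bsub>G\<^esub> v'}"
  have "E \<subseteq> (\<lambda>(v, v'). snd (the_inv_into (carrier (wreath_int H)) \<psi> (v \<otimes>\<^bsub>G\<^esub> inv\<^bsub>G\<^esub> v'))) ` (supp y \<times> supp y)"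
  proof
    fix d assume "d \<in> E"
    then obtain b v v' where *: "b \<in> base" "v \<in> supp y" "v' \<in> supp y" "\<psi> (b, d) = v \<otimes>\<^bsub>G\<^esub> inv\<^bsub>G\<^esub> v'"
      by (auto simp: E_def)
    have "(b, d) \<in> carrier (wreath_int H)"
      using *(1) by (auto simp: carrier_wreath_int[OF H.is_group] base_def)
    then have "snd (the_inv_into (carrier (wreath_int H)) \<psi> (v \<otimes>\<^bsub>G\<^esub> inv\<^bsub>G\<^esub> v')) = d"
      using the_inv_into_f_f[OF psi_inj] *(4) by (metis snd_conv)
    then show "d \<in> (\<lambda>(v, v'). snd (the_inv_into (carrier (wreath_int H)) \<psi> (v \<otimes>\<^bsub>G\<^esub> inv\<^bsub>G\<^esub> v'))) ` (supp y \<times> supp y)"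
      using *(2,3) by force
  qed
  then have fin: "finite E"
    using finite_supp[OF y] by (auto intro: finite_subset)
  define m where "m = Max (insert 0 E) + 1"
  have m: "d < m" if "d \<in> insert 0 E" for d
    using fin that Max_ge[of "insert 0 E" d] by (simp add: m_def del: Max_insert)
  have "supp (Ds js (delta (X i) \<otimes>\<^bsub>kG\<^esub> y)) \<inter> supp (Ds js (delta (X j) \<otimes>\<^bsub>kG\<^esub> y)) = {}"
    if ij: "i + m \<le> j" for js i j
  proof (rule ccontr)
    assume "\<not> ?thesis"
    then obtain w where "w \<in> supp (Ds js (delta (X i) \<otimes>\<^bsub>kG\<^esub> y))" "w \<in> supp (Ds js (delta (X j) \<otimes>\<^bsub>kG\<^esub> y))"
      by blast
    then have "w \<in> {\<psi> (b, i) \<otimes>\<^bsub>G\<^esub> v | b v. b \<in> base \<and> v \<in> supp y}"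
      "w \<in> {\<psi> (b, j) \<otimes>\<^bsub>G\<^esub> v | b v. b \<in> base \<and> v \<in> supp y}"
      using supp_Ds_translate[OF y, of js] by blast+
    then obtain b v b' v' where b: "b \<in> base" "b' \<in> base" and v: "v \<in> supp y" "v' \<in> supp y"
      and eq: "\<psi> (b, i) \<otimes>\<^bsub>G\<^esub> v = \<psi> (b', j) \<otimes>\<^bsub>G\<^esub> v'"
      by blast
    \<comment> \<open>the base component of the inverse of \<open>(b, i)\<close> in the wreath product\<close>
    define c where "c = (\<lambda>n. inv\<^bsub>H\<^esub> b (n + i))"
    have "finite {n. b (n + i) \<noteq> \<one>\<^bsub>H\<^esub>}"
      using b(1) finite_shift[of "\<lambda>n. b n \<noteq> \<one>\<^bsub>H\<^esub>" "- i"] by (simp add: base_def)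
    then have c: "c \<in> base"
      using b(1) by (simp add: base_def c_def H.inv_eq_1_iff)
    have inv: "\<psi> (c, - i) \<otimes>\<^bsub>G\<^esub> \<psi> (b, i) = \<one>\<^bsub>G\<^esub>"
      using psi_mult[OF c b(1), of "- i" i] b(1) psi_one by (simp add: c_def base_def)
    have "v = \<psi> (c, - i) \<otimes>\<^bsub>G\<^esub> (\<psi> (b, i) \<otimes>\<^bsub>G\<^esub> v)"
      using inv v psi_closed[OF c] psi_closed[OF b(1)] by (simp add: m_assoc[symmetric])
    also have "\<dots> = \<psi> (c, - i) \<otimes>\<^bsub>G\<^esub> \<psi> (b', j) \<otimes>\<^bsub>G\<^esub> v'"
      using v psi_closed[OF c] psi_closed[OF b(2)] by (simp add: eq m_assoc)
    finally have "v \<otimes>\<^bsub>G\<^esub> inv\<^bsub>G\<^esub> v' = \<psi> (c, - i) \<otimes>\<^bsub>G\<^esub> \<psi> (b', j)"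
      using v psi_closed[OF c] psi_closed[OF b(2)] by (simp add: m_assoc)
    then have "\<psi> (\<lambda>n. c n \<otimes>\<^bsub>H\<^esub> b' (n - (- i)), j - i) = v \<otimes>\<^bsub>G\<^esub> inv\<^bsub>G\<^esub> v'"
      by (simp add: psi_mult[OF c b(2)])
    then have "j - i \<in> E"
      unfolding E_def using base_mult[OF c b(2)] v by blast
    then show False
      using m[of "j - i"] ij by simp
  qed
  then show ?thesis
    using m[of 0] by blast
qed

text \<open>For \<open>i = 0\<close> this is the given equation multiplied by \<open>h\<^sub>0 - 1\<close>, which kills its right-hand
  side; multiplying by \<open>x\<^sup>i\<close> turns \<open>h\<^sub>0 - 1\<close> into \<open>h\<^sub>i - 1\<close> and gives the other cases.\<close>

lemma D_translate_step:
  assumes y: "y \<in> carrier kG" and z: "z \<in> carrier kG"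
    and eq: "(delta (X 1) \<ominus>\<^bsub>kG\<^esub> \<one>\<^bsub>kG\<^esub>) \<otimes>\<^bsub>kG\<^esub> y = norm_elt \<otimes>\<^bsub>kG\<^esub> z"
  shows "D i (delta (X (i + 1)) \<otimes>\<^bsub>kG\<^esub> y) = D i (delta (X i) \<otimes>\<^bsub>kG\<^esub> y)"
proof -
  let ?xy = "delta (X 1) \<otimes>\<^bsub>kG\<^esub> y"
  have xy: "?xy \<in> carrier kG"
    using y delta_closed by simp
  have "?xy \<ominus>\<^bsub>kG\<^esub> y = norm_elt \<otimes>\<^bsub>kG\<^esub> z"
    using y delta_closed eq by (simp add: kG.minus_eq kG.l_distr kG.l_minus)
  then have "D 0 ?xy \<ominus>\<^bsub>kG\<^esub> D 0 y = \<zero>\<^bsub>kG\<^esub>"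
    using D_minus[OF xy y, of 0] D_mult[OF norm_elt_closed z, of 0] D_norm_elt z by simp
  then have "D 0 ?xy = D 0 y"
    using D_closed[OF xy] D_closed[OF y] by simp
  then have "D i (delta (X i) \<otimes>\<^bsub>kG\<^esub> ?xy) = D i (delta (X i) \<otimes>\<^bsub>kG\<^esub> y)"
    using D_translate[OF xy, of i 0] D_translate[OF y, of i 0] by simp
  moreover have "delta (X i) \<otimes>\<^bsub>kG\<^esub> ?xy = delta (X (i + 1)) \<otimes>\<^bsub>kG\<^esub> y"
    using y by (simp add: kG.m_assoc[symmetric] delta_closed delta_mult X_closed X_add)
  ultimately show ?thesis by simp
qed

text \<open>The annihilator of \<open>z\<close> is the norm element multiplied by the \<open>h\<^sub>j - 1\<close> for indices \<open>j \<noteq> 0\<close> in a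
  symmetric interval. The positive indices are needed to move \<open>x y\<close> far up, the negative ones
  to move \<open>y\<close> far down.\<close>

lemma common_multiple_zero_divisor:
  assumes y: "y \<in> carrier kG" and z: "z \<in> carrier kG"
    and eq: "(delta (X 1) \<ominus>\<^bsub>kG\<^esub> \<one>\<^bsub>kG\<^esub>) \<otimes>\<^bsub>kG\<^esub> y = norm_elt \<otimes>\<^bsub>kG\<^esub> z"
  shows "\<not> non_zerodivisor kG z"
proof -
  obtain m :: int where "m > 0" and disj: "\<And>js i j. i + m \<le> j \<Longrightarrow>
      supp (Ds js (delta (X i) \<otimes>\<^bsub>kG\<^esub> y)) \<inter> supp (Ds js (delta (X j) \<otimes>\<^bsub>kG\<^esub> y)) = {}"
    using supp_Ds_translate_disjoint[OF y] by blast
  define js where "js = [- m..- 1] @ [1..m]"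
  define w where "w i = Ds js (delta (X i) \<otimes>\<^bsub>kG\<^esub> y)" for i
  have w_closed: "w i \<in> carrier kG" for i
    using y by (simp add: w_def Ds_closed delta_closed)
  have step: "w (i + 1) = w i" if "i \<in> set js" for i
    unfolding w_def using y that D_translate_step[OF y z eq, of i]
    by (intro Ds_eq_if_D_eq[of _ _ i]) (auto simp: delta_closed)
  have "w 1 = w (1 + int n)" if "int n \<le> m" for n
    using that
  proof (induction n)
    case (Suc n)
    then show ?case
      using step[of "1 + int n"] by (simp add: js_def add_ac)
  qed simp
  from this[of "nat m"] have w1: "w 1 = w (1 + m)"
    using \<open>m > 0\<close> by simp
  have "w 0 = w (- int n)" if "int n \<le> m" for n
    using that
  proof (induction n)
    case (Suc n)
    then show ?case
      using step[of "- 1 - int n"] by (simp add: js_def)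
  qed simp
  from this[of "nat m"] have w0: "w 0 = w (- m)"
    using \<open>m > 0\<close> by simp
  have "w 1 = \<zero>\<^bsub>kG\<^esub>"
    using disj[of 1 "1 + m" js] w1 nonzero_iff_supp[OF w_closed] by (auto simp flip: w_def)
  moreover have "w 0 = \<zero>\<^bsub>kG\<^esub>"
    using disj[of "- m" 0 js] w0 nonzero_iff_supp[OF w_closed] by (auto simp flip: w_def)
  moreover have "Ds js (norm_elt \<otimes>\<^bsub>kG\<^esub> z) = w 1 \<ominus>\<^bsub>kG\<^esub> w 0"
  proof -
    have "norm_elt \<otimes>\<^bsub>kG\<^esub> z = delta (X 1) \<otimes>\<^bsub>kG\<^esub> y \<ominus>\<^bsub>kG\<^esub> delta (X 0) \<otimes>\<^bsub>kG\<^esub> y"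
      using y delta_closed eq by (simp add: kG.minus_eq kG.l_distr kG.l_minus X_0 delta_one)
    then show ?thesis
      using y by (simp add: w_def Ds_minus delta_closed)
  qed
  ultimately have "Ds js norm_elt \<otimes>\<^bsub>kG\<^esub> z = \<zero>\<^bsub>kG\<^esub>"
    using z by (simp add: Ds_mult norm_elt_closed)
  moreover have "Ds js norm_elt \<noteq> \<zero>\<^bsub>kG\<^esub>"
  proof -
    have "supp norm_elt \<subseteq> slab {0}"
      by (auto simp: norm_elt_def)
    then show ?thesis
      using Ds_nonzero[OF norm_elt_closed norm_elt_nonzero, of "{0}" js] by (auto simp: js_def)
  qed
  ultimately show ?thesis
    using z Ds_closed[OF norm_elt_closed] by (auto simp: non_zerodivisor_def)
qed

lemma not_ore_condition: "\<not> ore_condition kG"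
proof -
  have "inj (\<lambda>n::nat. X 1 [^]\<^bsub>G\<^esub> n)"
    by (rule injI) (simp add: X_pow inj_eq[OF inj_X])
  then have s: "non_zerodivisor kG (delta (X 1) \<ominus>\<^bsub>kG\<^esub> \<one>\<^bsub>kG\<^esub>)"
    by (rule non_zerodivisor_delta_minus_one[OF X_closed])
  then have s_closed: "delta (X 1) \<ominus>\<^bsub>kG\<^esub> \<one>\<^bsub>kG\<^esub> \<in> carrier kG"
    by (simp add: non_zerodivisor_def)
  show ?thesis
  proof
    assume ore: "ore_condition kG"
    obtain z y where z: "z \<in> carrier kG" "non_zerodivisor kG z" and y: "y \<in> carrier kG"
      and eq: "(delta (X 1) \<ominus>\<^bsub>kG\<^esub> \<one>\<^bsub>kG\<^esub>) \<otimes>\<^bsub>kG\<^esub> y = norm_elt \<otimes>\<^bsub>kG\<^esub> z"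
      using ore[unfolded ore_condition_def, rule_format, OF s_closed norm_elt_closed s] by (elim bexE conjE)
    show False
      using common_multiple_zero_divisor[OF y z(1) eq] z(2) by (rule notE)
  qed
qed

end

theorem theorem3:
  fixes H :: "('h, 'a) monoid_scheme"
    and G :: "('g, 'b) monoid_scheme"
    and k :: "('k, 'c) ring_scheme"
    and W :: "'g set"
  assumes "group H"
    and "finite (carrier H)"
    and "carrier H \<noteq> {\<one>\<^bsub>H\<^esub>}"
    and "field k"
    and "group G"
    and "subgroup W G"
    and "G\<lparr>carrier := W\<rparr> \<cong> wreath_int H"
  shows "\<not> ore_condition (group_algebra k G)"
proof -
  interpret H: group H by fact
  interpret k: field k by fact
  interpret G: group G by fact
  obtain a where a: "a \<in> carrier H" "a \<noteq> \<one>\<^bsub>H\<^esub>"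
    using assms(3) H.one_closed by blast
  have "wreath_int H \<cong> G\<lparr>carrier := W\<rparr>"
    using group.iso_sym[OF subgroup.subgroup_is_group[OF assms(6,5)] assms(7)] .
  then obtain \<psi> where psi: "\<psi> \<in> hom (wreath_int H) (G\<lparr>carrier := W\<rparr>)"
      "inj_on \<psi> (carrier (wreath_int H))"
    by (auto simp: is_iso_def iso_def bij_betw_def)
  have "\<psi> \<in> hom (wreath_int H) G"
    using psi(1) subgroup.subset[OF assms(6)] by (auto simp: hom_def)
  then interpret wreath_embedding k G H \<psi> a
    using assms(2) a psi(2) k.one_not_zero by unfold_locales auto
  show ?thesis
    by (rule not_ore_condition)
qed

end
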